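(* Let $H(n,\sigma)$ denote the minimum, over all decision trees processing strings of length $n$ that find the Lempel-Ziv factorization, of the maximum, over all strings $t$ of length $n$ over a totally ordered alphabet containing at most $\sigma$ distinct letters, of the number of comparisons (edges) on the path from the root to the leaf reached by $t$. Then $H(n,\sigma) = \Omega(n\log\sigma)$. In words: constructing the Lempel-Ziv factorization of a string of length $n$ with at most $\sigma$ distinct letters requires $\Omega(n\log\sigma)$ comparisons of letters in the worst case.
   Context: Strings are over a totally (linearly) ordered alphabet; $t[i]$ is the $i$th letter and $t[i..j]=t[i]\cdots t[j]$. $\log$ is base $2$. Lempel-Ziv factorization: for a string $t$ of length $n$, it is the decomposition $t=t_1t_2\cdots t_k$ built greedily from left to right: $t_1=t[1]$; if $t_1\cdots t_{i-1}=t[1..j]$, then if $t[j+1]$ does not occur in $t[1..j]$ put $t_i=t[j+1]$, otherwise let $t_i$ be the longest prefix of $t[j+1..n]$ that has an occurrence starting at some position $\le j$. Two factorizations $t=t_1\cdots t_k$ and $t'=t'_1\cdots t'_{k'}$ of strings of the same length are equivalent if $k=k'$ and $|t_i|=|t'_i|$ for all $i$. Decision tree model: a decision tree processing strings of length $n$ is a rooted ternary tree in which each interior vertex is labeled with an ordered pair $(i,j)$, $1\le i,j\le n$, and its three outgoing edges are labeled $<$, $=$, $>$. A string $t$ of length $n$ reaches a vertex $v$ if along the root-to-$v$ path, every vertex labeled $(i,j)$ is left via the edge labeled by the actual relation between $t[i]$ and $t[j]$; each string reaches exactly one leaf. The height is the maximal number of edges on a root-to-leaf path. A decision tree processing strings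 of length $n$ finds the Lempel-Ziv factorization if any two strings of length $n$ reaching the same leaf have equivalent Lempel-Ziv factorizations. *)

theory Defs
  imports Complex_Main "HOL-Library.Sublist"
begin

subsection \<open>Lempel-Ziv factorization\<close>

text \<open>
  Lists are indexed from 0: the first \<open>j\<close> letters of \<open>t\<close> are \<open>take j t\<close>, the letter after them is
  \<open>t ! j\<close>, and the one-based start positions \<open>1, ..., j\<close> are the offsets \<open>p < j\<close>.
  An occurrence starting before offset \<open>j\<close> may overlap the factor itself.
\<close>

definition occurs_at :: "'a list \<Rightarrow> 'a list \<Rightarrow> nat \<Rightarrow> bool" where
  "occurs_at u t p \<longleftrightarrow> prefix u (drop p t)"

definition lz_factor_length :: "'a list \<Rightarrow> nat \<Rightarrow> nat" where
  "lz_factor_length t j =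
     (if t ! j \<notin> set (take j t) then 1
      else (GREATEST l. j + l \<le> length t \<and> (\<exists>p<j. occurs_at (take l (drop j t)) t p)))"

lemma lz_factor_length_pos:
  assumes "j < length t"
  shows "0 < lz_factor_length t j"
proof (cases "t ! j \<in> set (take j t)")
  case False
  then show ?thesis by (simp add: lz_factor_length_def)
next
  case True
  let ?P = "\<lambda>l. j + l \<le> length t \<and> (\<exists>p<j. occurs_at (take l (drop j t)) t p)"
  from True obtain p where p: "p < j" "t ! p = t ! j"
    by (auto simp: in_set_conv_nth)
  have "drop j t = t ! j # drop (Suc j) t" "drop p t = t ! j # drop (Suc p) t"
    using assms p Cons_nth_drop_Suc[of j t] Cons_nth_drop_Suc[of p t] by simp_all
  then have "?P 1"
    using assms p(1) by (auto simp: occurs_at_def)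
  then have "1 \<le> (GREATEST l. ?P l)"
    by (rule Greatest_le_nat[where b = "length t"]) auto
  with True show ?thesis by (simp add: lz_factor_length_def)
qed

function lz_from :: "'a list \<Rightarrow> nat \<Rightarrow> 'a list list" where
  "lz_from t j =
     (if j < length t
      then take (lz_factor_length t j) (drop j t) # lz_from t (j + lz_factor_length t j)
      else [])"
  by pat_completeness auto
termination
  by (relation "measure (\<lambda>(t, j). length t - j)")
    (auto dest: lz_factor_length_pos intro!: diff_less_mono2)

declare lz_from.simps [simp del]

definition lz_factorization :: "'a list \<Rightarrow> 'a list list" where
  "lz_factorization t = lz_from t 0"

definition equivalent_factorizations :: "'a list list \<Rightarrow> 'a list list \<Rightarrow> bool" where
  "equivalent_factorizations fs gs \<longleftrightarrow>
     length fs = length gs \<and> (\<forall>i<length fs. length (fs ! i) = length (gs ! i))"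

subsection \<open>Decision trees\<close>

datatype edge = LT | EQ | GT

text \<open>\<open>Node i j l e g\<close> has label \<open>(i, j)\<close> (one-based positions) and its edges labelled
  \<open><\<close>, \<open>=\<close>, \<open>>\<close> lead to \<open>l\<close>, \<open>e\<close>, \<open>g\<close>.\<close>

datatype dtree = Leaf | Node nat nat dtree dtree dtree

primrec processes_length :: "nat \<Rightarrow> dtree \<Rightarrow> bool" where
  "processes_length n Leaf \<longleftrightarrow> True"
| "processes_length n (Node i j l e g) \<longleftrightarrow>
     i \<in> {1..n} \<and> j \<in> {1..n} \<and>
     processes_length n l \<and> processes_length n e \<and> processes_length n g"

text \<open>A vertex is addressed by the sequence of edge labels on the path from the root, so two
  strings reach the same leaf iff their values of \<open>leaf_reached\<close> agree, and the length of this
  value is the number of comparisons made.\<close>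

primrec leaf_reached :: "dtree \<Rightarrow> 'a::linorder list \<Rightarrow> edge list" where
  "leaf_reached Leaf t = []"
| "leaf_reached (Node i j l e g) t =
     (if t ! (i - 1) < t ! (j - 1) then LT # leaf_reached l t
      else if t ! (i - 1) = t ! (j - 1) then EQ # leaf_reached e t
      else GT # leaf_reached g t)"

definition strings :: "'a set \<Rightarrow> nat \<Rightarrow> 'a list set" where
  "strings A n = {t. set t \<subseteq> A \<and> length t = n}"

definition finds_lz :: "'a::linorder set \<Rightarrow> nat \<Rightarrow> dtree \<Rightarrow> bool" where
  "finds_lz A n T \<longleftrightarrow>
     (\<forall>t\<in>strings A n. \<forall>t'\<in>strings A n. leaf_reached T t = leaf_reached T t' \<longrightarrow>
        equivalent_factorizations (lz_factorization t) (lz_factorization t'))"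

definition worst_case_comparisons :: "'a::linorder set \<Rightarrow> nat \<Rightarrow> nat \<Rightarrow> dtree \<Rightarrow> nat" where
  "worst_case_comparisons A n \<sigma> T =
     Max {length (leaf_reached T t) |t. t \<in> strings A n \<and> card (set t) \<le> \<sigma>}"

text \<open>The infimum is a minimum: the tree that compares all pairs of positions finds the
  factorization, so it is not taken over the empty set. The maximum is over a set bounded by the
  height of the tree, even if the alphabet \<open>A\<close> is infinite.\<close>

definition H :: "'a::linorder set \<Rightarrow> nat \<Rightarrow> nat \<Rightarrow> nat" where
  "H A n \<sigma> = Inf {worst_case_comparisons A n \<sigma> T |T. processes_length n T \<and> finds_lz A n T}"

end

theory Submission
  imports Defs
begin

text \<open>
  Let \<open>b\<^sub>0 < b\<^sub>1 < \<dots> < b\<^sub>2\<^sub>k\<^sub>-\<^sub>1 = z\<close> be letters with \<open>k\<close> about \<open>\<sigma> / 4\<close>, and consider the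
  \<open>k\<^sup>m\<close> strings \<open>b\<^sub>0 z b\<^sub>2 z \<dots> b\<^sub>2\<^sub>k\<^sub>-\<^sub>2 z x\<^sub>1 z x\<^sub>2 z \<dots> x\<^sub>m z\<close> in which the \<open>x\<^sub>i\<close> are arbitrary
  letters of even index. Every \<open>x\<^sub>i z\<close> has occurred before, so no factor of length 1 starts at an \<open>x\<^sub>i\<close>.
  Suppose that two such strings \<open>t\<close>, \<open>t'\<close> reach the same leaf, let \<open>i\<close> be the first position at which
  they differ, and say \<open>t[i] = b\<^sub>2\<^sub>x < t'[i]\<close>. The comparisons made cannot link the positions \<open>p\<close>
  with \<open>t[p] = t[i]\<close> and \<open>t'[p] = t'[i]\<close> by an equality to any other position, so raising \<open>t\<close> to
  \<open>b\<^sub>2\<^sub>x\<^sub>+\<^sub>1\<close> at all these positions leads to the same leaf. But then a new letter appears at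
  position \<open>i\<close>, which forces a factor of length 1 there: a contradiction. Hence the tree has at least
  \<open>k\<^sup>m\<close> leaves reached by these strings. For bounded \<open>\<sigma>\<close> it is enough that on \<open>a\<^sup>n\<close> almost every
  position must take part in a comparison.
\<close>

subsection \<open>Factor lengths\<close>

lemma occurs_at_iff_nth:
  assumes "j + l \<le> length t" "p \<le> j"
  shows "occurs_at (take l (drop j t)) t p \<longleftrightarrow> (\<forall>q<l. t ! (j + q) = t ! (p + q))"
proof -
  have "occurs_at (take l (drop j t)) t p \<longleftrightarrow> take l (drop p t) = take l (drop j t)"
    using assms by (auto simp: occurs_at_def prefix_def min_def) (metis append_take_drop_id)
  also have "\<dots> \<longleftrightarrow> (\<forall>q<l. t ! (j + q) = t ! (p + q))"
    using assms by (auto simp: list_eq_iff_nth_eq)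
  finally show ?thesis .
qed

lemma in_set_take_iff_nth:
  assumes "j \<le> length t"
  shows "x \<in> set (take j t) \<longleftrightarrow> (\<exists>p<j. t ! p = x)"
  using assms by (auto simp: in_set_conv_nth)

text \<open>Written letter by letter, the length depends only on which letters are equal; this is
  what makes two strings comparable.\<close>

lemma lz_factor_length_eq_nth:
  assumes "j < length t"
  shows "lz_factor_length t j =
    (if \<forall>p<j. t ! p \<noteq> t ! j then 1
     else (GREATEST l. j + l \<le> length t \<and> (\<exists>p<j. \<forall>q<l. t ! (j + q) = t ! (p + q))))"
proof -
  have "(\<lambda>l. j + l \<le> length t \<and> (\<exists>p<j. occurs_at (take l (drop j t)) t p)) =
    (\<lambda>l. j + l \<le> length t \<and> (\<exists>p<j. \<forall>q<l. t ! (j + q) = t ! (p + q)))"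
    using occurs_at_iff_nth[of j _ t] by (intro ext) (meson less_imp_le)
  then show ?thesis
    using assms by (auto simp: lz_factor_length_def in_set_take_iff_nth)
qed

lemma lz_factor_length_fresh:
  assumes "j < length t" "\<forall>p<j. t ! p \<noteq> t ! j"
  shows "lz_factor_length t j = 1"
  using assms by (simp add: lz_factor_length_eq_nth)

lemma lz_factor_length_repeated:
  assumes "j < length t" "p < j" "t ! p = t ! j"
  shows "j + lz_factor_length t j \<le> length t"
    and "\<exists>p<j. \<forall>q<lz_factor_length t j. t ! (j + q) = t ! (p + q)"
proof -
  let ?P = "\<lambda>l. j + l \<le> length t \<and> (\<exists>p<j. \<forall>q<l. t ! (j + q) = t ! (p + q))"
  \<comment> \<open>The empty prefix qualifies and \<open>length t\<close> bounds all candidates, so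
    the greatest value is attained.\<close>
  have "?P 0"
    using assms by auto
  then have "?P (GREATEST l. ?P l)"
    by (rule GreatestI_nat[where b = "length t"]) auto
  moreover have "lz_factor_length t j = (GREATEST l. ?P l)"
    using assms by (auto simp: lz_factor_length_eq_nth)
  ultimately show "j + lz_factor_length t j \<le> length t"
    and "\<exists>p<j. \<forall>q<lz_factor_length t j. t ! (j + q) = t ! (p + q)"
    by simp_all
qed

lemma lz_factor_length_le:
  assumes "j < length t"
  shows "j + lz_factor_length t j \<le> length t"
  using assms lz_factor_length_fresh[of j t] lz_factor_length_repeated(1)[of j t]
  by (cases "\<forall>p<j. t ! p \<noteq> t ! j") auto

lemma lz_factor_length_ge:
  assumes "0 < l" "p < j" "j + l \<le> length t" "\<forall>q<l. t ! (j + q) = t ! (p + q)"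
  shows "l \<le> lz_factor_length t j"
proof -
  let ?P = "\<lambda>l. j + l \<le> length t \<and> (\<exists>p<j. \<forall>q<l. t ! (j + q) = t ! (p + q))"
  have "l \<le> (GREATEST l. ?P l)"
    using assms by (intro Greatest_le_nat[where b = "length t"]) auto
  moreover have "t ! p = t ! j"
    using assms(1,4) by fastforce
  ultimately show ?thesis
    using assms by (auto simp: lz_factor_length_eq_nth)
qed

text \<open>A factor that starts with a repeated letter is copied from some \<open>p < j\<close>; if
  it covered \<open>i\<close>, the letter at \<open>i\<close> would also stand at
  \<open>p + (i - j) < i\<close>.\<close>

lemma fresh_not_inside_factor:
  assumes "j < i" "i < length t" "\<forall>p<i. t ! p \<noteq> t ! i"
  shows "j + lz_factor_length t j \<le> i"
proof (cases "\<forall>p<j. t ! p \<noteq> t ! j")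
  case True
  then show ?thesis
    using assms by (simp add: lz_factor_length_fresh)
next
  case False
  then obtain p where p: "p < j" "\<forall>q<lz_factor_length t j. t ! (j + q) = t ! (p + q)"
    using lz_factor_length_repeated(2)[of j t] assms by (meson order.strict_trans)
  show ?thesis
  proof (rule ccontr)
    assume "\<not> ?thesis"
    then have "i - j < lz_factor_length t j"
      using assms(1) by linarith
    then have "t ! (j + (i - j)) = t ! (p + (i - j))"
      using p(2) by blast
    moreover have "p + (i - j) < i"
      using p(1) assms(1) by simp
    ultimately show False
      using assms by auto
  qed
qed

section \<open>Comparing the factorizations of two strings\<close>

lemma length_hd_lz_from:
  assumes "j < length t"
  shows "length (take (lz_factor_length t j) (drop j t)) = lz_factor_length t j"
  using lz_factor_length_le[OF assms] by simp

lemma equivalent_factorizations_Cons: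
  "equivalent_factorizations (x # xs) (y # ys) \<longleftrightarrow>
     length x = length y \<and> equivalent_factorizations xs ys"
  by (auto simp: equivalent_factorizations_def nth_Cons split: nat.splits)

text \<open>No factor of \<open>t'\<close> runs over its fresh letter, so one of length 1 starts at
  \<open>i\<close>; equal lengths carry this over to \<open>t\<close>. The induction moves along the
  common factor boundaries \<open>j\<close>.\<close>

lemma lz_factor_length_if_equivalent_fresh:
  assumes "equivalent_factorizations (lz_from t j) (lz_from t' j)"
    and "length t = length t'" "j \<le> i" "i < length t"
    and fresh: "\<forall>p<i. t' ! p \<noteq> t' ! i"
  shows "lz_factor_length t i = 1"
  using assms
proof (induction "length t - j" arbitrary: j rule: less_induct)
  case less
  have j: "j < length t" "j < length t'"
    using less.prems by auto
  have eq: "lz_factor_length t j = lz_factor_length t' j"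
    and rest: "equivalent_factorizations (lz_from t (j + lz_factor_length t j))
      (lz_from t' (j + lz_factor_length t' j))"
    using less.prems(1) j length_hd_lz_from[OF j(1)] length_hd_lz_from[OF j(2)]
    by (simp_all add: lz_from.simps[of t j] lz_from.simps[of t' j] equivalent_factorizations_Cons)
  show ?case
  proof (cases "i = j")
    case True
    then show ?thesis
      using eq fresh lz_factor_length_fresh[of i t'] j by simp
  next
    case False
    then have "j + lz_factor_length t j \<le> i"
      using less.prems eq fresh_not_inside_factor[of j i t'] by simp
    then show ?thesis
      using less.hyps[of "j + lz_factor_length t j"] less.prems rest eq j
        lz_factor_length_pos[OF j(1)] by simp
  qed
qed

lemma equivalent_lz_from_if_same_equalities:
  assumes "length t = length t'"
    and "\<forall>p<length t. \<forall>q<length t. t ! p = t ! q \<longleftrightarrow> t' ! p = t' ! q"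
  shows "equivalent_factorizations (lz_from t j) (lz_from t' j)"
proof (induction "length t - j" arbitrary: j rule: less_induct)
  case less
  show ?case
  proof (cases "j < length t")
    case False
    then show ?thesis
      using assms(1) by (simp add: lz_from.simps[of t j] lz_from.simps[of t' j]
          equivalent_factorizations_def)
  next
    case j: True
    have "(\<lambda>l. j + l \<le> length t \<and> (\<exists>p<j. \<forall>q<l. t ! (j + q) = t ! (p + q))) =
      (\<lambda>l. j + l \<le> length t' \<and> (\<exists>p<j. \<forall>q<l. t' ! (j + q) = t' ! (p + q)))"
      using assms by (intro ext) (auto; fastforce)
    moreover have "(\<forall>p<j. t ! p \<noteq> t ! j) \<longleftrightarrow> (\<forall>p<j. t' ! p \<noteq> t' ! j)"
      using assms j by auto
    moreover have "j < length t'"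
      using j assms(1) by simp
    ultimately have eq: "lz_factor_length t j = lz_factor_length t' j"
      by (simp only: lz_factor_length_eq_nth j)
    then have "equivalent_factorizations (lz_from t (j + lz_factor_length t j))
      (lz_from t' (j + lz_factor_length t' j))"
      using less[of "j + lz_factor_length t j"] j lz_factor_length_pos[OF j] by simp
    then show ?thesis
      using eq j assms(1)
      by (simp add: lz_from.simps[of t j] lz_from.simps[of t' j] equivalent_factorizations_Cons)
  qed
qed

subsection \<open>Decision trees\<close>

text \<open>The pairs queried on the path of \<open>t\<close>, as offsets: a change that keeps the
  relations at these pairs keeps the leaf.\<close>

primrec comparisons :: "dtree \<Rightarrow> 'a::linorder list \<Rightarrow> (nat \<times> nat) list" where
  "comparisons Leaf t = []"
| "comparisons (Node i j l e g) t = (i - 1, j - 1) #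
     (if t ! (i - 1) < t ! (j - 1) then comparisons l t
      else if t ! (i - 1) = t ! (j - 1) then comparisons e t
      else comparisons g t)"

lemma length_comparisons: "length (comparisons T t) = length (leaf_reached T t)"
  by (induction T) auto

lemma comparisons_in_range:
  assumes "processes_length n T" "(p, q) \<in> set (comparisons T t)"
  shows "p < n" "q < n"
  using assms by (induction T) (auto split: if_splits)

lemma leaf_reached_eqI:
  assumes "\<forall>(p, q)\<in>set (comparisons T t).
    (t ! p < t ! q \<longleftrightarrow> t' ! p < t' ! q) \<and> (t ! p = t ! q \<longleftrightarrow> t' ! p = t' ! q)"
  shows "leaf_reached T t = leaf_reached T t'"
  using assms by (induction T) (auto split: if_splits)

lemma leaf_reached_eqD:
  assumes "leaf_reached T t = leaf_reached T t'" "(p, q) \<in> set (comparisons T t)"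
  shows "t ! p = t ! q \<longleftrightarrow> t' ! p = t' ! q"
  using assms by (induction T) (auto split: if_splits)

section \<open>Path lengths and a tree attaining the minimum\<close>

primrec height :: "dtree \<Rightarrow> nat" where
  "height Leaf = 0"
| "height (Node i j l e g) = Suc (max (height l) (max (height e) (height g)))"

lemma length_leaf_reached_le_height: "length (leaf_reached T t) \<le> height T"
  by (induction T) auto

lemma length_leaf_reached_le_worst_case:
  assumes "t \<in> strings A n" "card (set t) \<le> \<sigma>"
  shows "length (leaf_reached T t) \<le> worst_case_comparisons A n \<sigma> T"
  unfolding worst_case_comparisons_def
proof (rule Max_ge)
  \<comment> \<open>\<open>strings A n\<close> may be infinite, so finiteness comes from the height
    of the tree.\<close>
  show "finite {length (leaf_reached T t) |t. t \<in> strings A n \<and> card (set t) \<le> \<sigma>}"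
    by (rule finite_subset[of _ "{..height T}"]) (auto simp: length_leaf_reached_le_height)
qed (use assms in auto)

text \<open>All three answers lead to the same subtree, so the queries do not depend on the
  string.\<close>

primrec full_tree :: "(nat \<times> nat) list \<Rightarrow> dtree" where
  "full_tree [] = Leaf"
| "full_tree (ij # ps) = Node (fst ij) (snd ij) (full_tree ps) (full_tree ps) (full_tree ps)"

lemma processes_length_full_tree:
  assumes "set ps \<subseteq> {1..n} \<times> {1..n}"
  shows "processes_length n (full_tree ps)"
  using assms by (induction ps) auto

lemma comparisons_full_tree:
  "comparisons (full_tree ps) t = map (\<lambda>(i, j). (i - 1, j - 1)) ps"
  by (induction ps) auto

text \<open>Querying all pairs reveals the equality pattern, which determines the factor
  lengths.\<close>

lemma ex_tree_finds_lz:
  "\<exists>T. processes_length n T \<and> finds_lz (A :: 'a::linorder set) n T"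
proof (intro exI conjI)
  let ?ps = "List.product [1..<Suc n] [1..<Suc n]"
  show "processes_length n (full_tree ?ps)"
    by (rule processes_length_full_tree) auto
  show "finds_lz A n (full_tree ?ps)"
    unfolding finds_lz_def
  proof (intro ballI impI)
    fix t t' :: "'a list"
    assume t: "t \<in> strings A n" and t': "t' \<in> strings A n"
      and leaf: "leaf_reached (full_tree ?ps) t = leaf_reached (full_tree ?ps) t'"
    have "t ! p = t ! q \<longleftrightarrow> t' ! p = t' ! q" if "p < n" "q < n" for p q
    proof (rule leaf_reached_eqD[OF leaf])
      have "(Suc p, Suc q) \<in> set ?ps"
        using that by auto
      then have "(\<lambda>(i, j). (i - 1, j - 1)) (Suc p, Suc q) \<in> set (comparisons (full_tree ?ps) t)"
        unfolding comparisons_full_tree set_map by (rule imageI)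
      then show "(p, q) \<in> set (comparisons (full_tree ?ps) t)"
        by simp
    qed
    then show "equivalent_factorizations (lz_factorization t) (lz_factorization t')"
      using t t' unfolding lz_factorization_def strings_def
      by (intro equivalent_lz_from_if_same_equalities) auto
  qed
qed

text \<open>Turns a lower bound for every correct tree into one for \<open>H\<close>.\<close>

lemma H_attained:
  obtains T where "processes_length n T" "finds_lz (A :: 'a::linorder set) n T"
    "H A n \<sigma> = worst_case_comparisons A n \<sigma> T"
proof -
  have "H A n \<sigma> \<in> {worst_case_comparisons A n \<sigma> T |T. processes_length n T \<and> finds_lz A n T}"
    unfolding H_def using ex_tree_finds_lz[of n A] by (intro Inf_nat_def1) auto
  then show ?thesis
    using that by auto
qed

text \<open>Source of both contradictions below: a modified string with a fresh letter at
  \<open>i\<close> reaches the leaf of a string whose factor length at \<open>i\<close> is at least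
  2.\<close>

lemma lz_factor_length_if_same_leaf_fresh:
  assumes "finds_lz A n T" "t \<in> strings A n" "t' \<in> strings A n"
    and "leaf_reached T t = leaf_reached T t'"
    and "i < n" "\<forall>p<i. t' ! p \<noteq> t' ! i"
  shows "lz_factor_length t i = 1"
  using assms lz_factor_length_if_equivalent_fresh[of t 0 t' i]
  unfolding finds_lz_def lz_factorization_def strings_def by auto

subsection \<open>Linear lower bound\<close>

lemma linear_lower_bound:
  assumes T: "processes_length n T" "finds_lz A n T"
    and A: "a \<in> A" "b \<in> A" "a \<noteq> b" and "1 \<le> \<sigma>"
  shows "n \<le> 2 * worst_case_comparisons A n \<sigma> T + 2"
proof -
  define t where "t = replicate n a"
  define cs where "cs = comparisons T t"
  have t: "t \<in> strings A n" "length t = n"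
    using A by (auto simp: t_def strings_def)
  \<comment> \<open>Offset 0 has no earlier letter to copy, and at offset \<open>n - 1\<close> there
    is no room for a factor of length 2.\<close>
  have touched: "i \<in> fst ` set cs \<union> snd ` set cs" if i: "1 \<le> i" "i < n - 1" for i
  proof (rule ccontr)
    assume untouched: "i \<notin> fst ` set cs \<union> snd ` set cs"
    \<comment> \<open>\<open>t'\<close> may have more than \<open>\<sigma>\<close> distinct letters:
      correctness of the tree is demanded for all strings over \<open>A\<close>.\<close>
    define t' where "t' = t[i := b]"
    have "t' \<in> strings A n"
      using A set_update_subset_insert[of t i b] t by (auto simp: t'_def strings_def)
    moreover have "leaf_reached T t = leaf_reached T t'"
    proof (rule leaf_reached_eqI, clarify)
      fix p q assume "(p, q) \<in> set (comparisons T t)"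
      then have "p \<noteq> i" "q \<noteq> i"
        using untouched by (force simp: cs_def)+
      then show "(t ! p < t ! q \<longleftrightarrow> t' ! p < t' ! q) \<and> (t ! p = t ! q \<longleftrightarrow> t' ! p = t' ! q)"
        by (simp add: t'_def)
    qed
    moreover have "\<forall>p<i. t' ! p \<noteq> t' ! i"
      using i A by (auto simp: t'_def t_def)
    ultimately have "lz_factor_length t i = 1"
      using lz_factor_length_if_same_leaf_fresh[OF T(2) t(1)] i by auto
    moreover have "2 \<le> lz_factor_length t i"
      using i by (intro lz_factor_length_ge[where p = 0]) (auto simp: t_def)
    ultimately show False
      by simp
  qed
  have "n - 2 = card {1..<n - 1}"
    by simp
  also have "\<dots> \<le> card (fst ` set cs \<union> snd ` set cs)"
    using touched by (intro card_mono subsetI) (simp, meson atLeastLessThan_iff)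
  also have "\<dots> \<le> card (fst ` set cs) + card (snd ` set cs)"
    by (rule card_Un_le)
  also have "\<dots> \<le> length cs + length cs"
    by (meson add_mono card_image_le card_length finite_set le_trans)
  also have "length cs \<le> worst_case_comparisons A n \<sigma> T"
  proof -
    have "card (set t) \<le> \<sigma>"
      using \<open>1 \<le> \<sigma>\<close> by (simp add: t_def set_replicate_conv_if)
    then show ?thesis
      unfolding cs_def length_comparisons using t by (intro length_leaf_reached_le_worst_case)
  qed
  finally show ?thesis
    by simp
qed

subsection \<open>Strings reaching distinct leaves\<close>

text \<open>Compared positions with equal letters in \<open>t\<close> have equal letters in
  \<open>t'\<close>, so both or neither are raised. Any other comparison keeps its outcome since no
  letter of \<open>t\<close> lies above \<open>t ! i\<close> and at or below
  \<open>v\<close>.\<close>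

lemma leaf_reached_raise_common_class:
  fixes t t' :: "'a::linorder list"
  assumes leaf: "leaf_reached T t = leaf_reached T t'"
    and T: "processes_length (length t) T"
    and gap: "t ! i < v" "\<forall>u\<in>set t. u \<le> t ! i \<or> v < u"
  defines "s \<equiv> map (\<lambda>p. if t ! p = t ! i \<and> t' ! p = t' ! i then v else t ! p) [0..<length t]"
  shows "leaf_reached T t = leaf_reached T s"
proof (rule leaf_reached_eqI, clarify)
  fix p q assume pq: "(p, q) \<in> set (comparisons T t)"
  then have len: "p < length t" "q < length t"
    using comparisons_in_range[OF T] by auto
  then have "t ! p \<le> t ! i \<or> v < t ! p" "t ! q \<le> t ! i \<or> v < t ! q"
    using gap by auto
  moreover have "t ! p = t ! q \<longleftrightarrow> t' ! p = t' ! q"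
    using leaf_reached_eqD[OF leaf pq] .
  ultimately show "(t ! p < t ! q \<longleftrightarrow> s ! p < s ! q) \<and> (t ! p = t ! q \<longleftrightarrow> s ! p = s ! q)"
    using len gap(1) by (auto simp: s_def)
qed

text \<open>The top letter \<open>b (2 * k - 1)\<close> is both separator and padding up to length
  \<open>n\<close>. The odd indices below it stay free to supply fresh letters.\<close>

definition hard_string :: "(nat \<Rightarrow> 'a) \<Rightarrow> nat \<Rightarrow> nat \<Rightarrow> nat list \<Rightarrow> 'a list" where
  "hard_string b n k w = map (\<lambda>p. if even p \<and> p div 2 < k + length w
     then b (2 * (([0..<k] @ w) ! (p div 2))) else b (2 * k - 1)) [0..<n]"

lemma length_hard_string [simp]: "length (hard_string b n k w) = n"
  by (simp add: hard_string_def)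

lemma hard_string_nth:
  assumes "p < n"
  shows "hard_string b n k w ! p = (if even p \<and> p div 2 < k + length w
     then b (2 * (([0..<k] @ w) ! (p div 2))) else b (2 * k - 1))"
  using assms by (simp add: hard_string_def)

lemma append_upt_nth_less:
  assumes "set w \<subseteq> {..<k}" "i < k + length w"
  shows "([0..<k] @ w) ! i < k"
proof (cases "i < k")
  case False
  then have "w ! (i - k) \<in> set w"
    using assms(2) by (intro nth_mem) simp
  then show ?thesis
    using False assms(1) by (auto simp: nth_append)
qed (simp add: nth_append)

lemma hard_string_letters:
  assumes "set w \<subseteq> {..<k}" "0 < k"
  shows "set (hard_string b n k w) \<subseteq> (\<lambda>x. b (2 * x)) ` {..<k} \<union> {b (2 * k - 1)}"
  using append_upt_nth_less[OF assms(1)] by (auto simp: hard_string_def)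

text \<open>The letter \<open>b (2 * x)\<close> at \<open>i\<close> and the separator after it
  already stand at offset \<open>2 * x\<close>, inside the fixed initial block.\<close>

lemma lz_factor_length_hard_string:
  assumes w: "set w \<subseteq> {..<k}" and n: "2 * (k + length w) \<le> n"
    and i: "even i" "2 * k \<le> i" "i < 2 * (k + length w)"
  shows "2 \<le> lz_factor_length (hard_string b n k w) i"
proof -
  define x where "x = ([0..<k] @ w) ! (i div 2)"
  have x: "x < k"
    unfolding x_def using i by (intro append_upt_nth_less[OF w]) auto
  have len: "Suc i < n"
    using i n by presburger
  have "hard_string b n k w ! (i + q) = hard_string b n k w ! (2 * x + q)" if "q < 2" for q
  proof (cases "q = 0")
    case True
    then show ?thesis
      using x i len by (auto simp: hard_string_nth x_def[symmetric] nth_append[of "[0..<k]" w x])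
  next
    case False
    then show ?thesis
      using that x i len by (auto simp: hard_string_nth)
  qed
  then show ?thesis
    using x i len by (intro lz_factor_length_ge[where p = "2 * x"]) auto
qed

text \<open>The string with the smaller letter at the first difference is the one raised, since a
  free letter lies just above that letter.\<close>

lemma hard_strings_distinct_leaves_aux:
  fixes b :: "nat \<Rightarrow> 'a::linorder"
  assumes T: "processes_length n T" "finds_lz A n T"
    and b: "strict_mono_on {..<2 * k} b" "b ` {..<2 * k} \<subseteq> A"
    and w: "set w \<subseteq> {..<k}" "set w' \<subseteq> {..<k}" "length w' = length w"
    and n: "2 * (k + length w) \<le> n"
    and leaf: "leaf_reached T (hard_string b n k w) = leaf_reached T (hard_string b n k w')"
    and i: "i < length w" "w ! i < w' ! i" "\<forall>p<i. w ! p = w' ! p"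
  shows False
proof -
  define t where "t = hard_string b n k w"
  define t' where "t' = hard_string b n k w'"
  define x where "x = w ! i"
  define I where "I = 2 * (k + i)"
  \<comment> \<open>As \<open>x\<close> is below another index, it is not the last one, so
    \<open>b (2 * x + 1)\<close> differs from the separator.\<close>
  have x: "Suc x < k" "w' ! i < k"
  proof -
    show "w' ! i < k"
      using i(1) w(2,3) by (metis lessThan_iff nth_mem subsetD)
    then show "Suc x < k"
      using i(2) by (simp add: x_def)
  qed
  have less: "b p < b q \<longleftrightarrow> p < q" if "p < 2 * k" "q < 2 * k" for p q
    using strict_mono_on_less[OF b(1)] that by simp
  have I: "I < n" "even I" "2 * k \<le> I" "I < 2 * (k + length w)"
    using n i by (auto simp: I_def)
  have tI: "t ! I = b (2 * x)" "t' ! I = b (2 * (w' ! i))"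
    using I(1) i w(3) unfolding t_def t'_def
    by (auto simp: hard_string_nth I_def x_def nth_append)
  have tI_less: "t ! I < t' ! I"
    using tI i(2) x by (simp add: less x_def)
  have agree: "t ! p = t' ! p" if "p < I" for p
  proof -
    have "([0..<k] @ w) ! (p div 2) = ([0..<k] @ w') ! (p div 2)"
      using that i(3) by (auto simp: nth_append I_def)
    then show ?thesis
      using that I(1) w(3) by (simp add: t_def t'_def hard_string_nth)
  qed
  have t_letters: "set t \<subseteq> (\<lambda>x. b (2 * x)) ` {..<k} \<union> {b (2 * k - 1)}"
    unfolding t_def using x by (intro hard_string_letters[OF w(1)]) auto
  have gap: "u \<le> t ! I \<or> b (2 * x + 1) < u" if u: "u \<in> set t" for u
  proof -
    obtain y where y: "u = b y" "y < 2 * k" "even y \<or> y = 2 * k - 1"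
      using t_letters u x by fastforce
    then have "y < 2 * x \<or> y = 2 * x \<or> 2 * x + 1 < y"
      using x by (auto elim!: evenE)
    then show ?thesis
      using y x less[of y "2 * x"] less[of "2 * x + 1" y] by (auto simp: tI)
  qed
  define s where "s = map (\<lambda>p. if t ! p = t ! I \<and> t' ! p = t' ! I then b (2 * x + 1) else t ! p)
    [0..<length t]"
  have len: "length t = n"
    by (simp add: t_def)
  have "leaf_reached T t = leaf_reached T s"
    unfolding s_def
    using leaf T(1) gap x by (intro leaf_reached_raise_common_class)
      (auto simp: t_def[symmetric] t'_def[symmetric] tI less len)
  moreover have t: "t \<in> strings A n"
    using t_letters b(2) x len by (fastforce simp: strings_def)
  moreover have "b (2 * x + 1) \<in> A"
    using b(2) x by auto
  with t have "s \<in> strings A n"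
    by (auto simp: strings_def s_def)
  moreover have "s ! p \<noteq> s ! I" if "p < I" for p
  proof -
    \<comment> \<open>Before \<open>I\<close> the two strings agree, so an offset \<open>p\<close>
      in the raised class would force \<open>t ! I = t' ! I\<close>.\<close>
    have "s ! p = t ! p" "s ! I = b (2 * x + 1)"
      using that I(1) agree[OF that] tI_less by (auto simp: s_def len)
    moreover have "t ! p \<in> set t"
      using that I(1) len by simp
    moreover have "t ! I < b (2 * x + 1)"
      using x by (simp add: tI less)
    ultimately show ?thesis
      using gap[of "t ! p"] by auto
  qed
  ultimately have "lz_factor_length t I = 1"
    using lz_factor_length_if_same_leaf_fresh[OF T(2)] I(1) by blast
  moreover have "2 \<le> lz_factor_length t I"
    unfolding t_def using I n w by (intro lz_factor_length_hard_string) auto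
  ultimately show False
    by simp
qed

lemma hard_strings_distinct_leaves:
  fixes b :: "nat \<Rightarrow> 'a::linorder"
  assumes T: "processes_length n T" "finds_lz A n T"
    and b: "strict_mono_on {..<2 * k} b" "b ` {..<2 * k} \<subseteq> A"
    and n: "2 * (k + m) \<le> n"
  shows "inj_on (\<lambda>w. leaf_reached T (hard_string b n k w)) {w. set w \<subseteq> {..<k} \<and> length w = m}"
proof (rule inj_onI, rule ccontr, clarify)
  fix w w'
  assume w: "set w \<subseteq> {..<k}" "m = length w" "set w' \<subseteq> {..<k}" "length w' = length w"
    and leaf: "leaf_reached T (hard_string b n k w) = leaf_reached T (hard_string b n k w')"
    and "w \<noteq> w'"
  then have "\<exists>i. i < length w \<and> w ! i \<noteq> w' ! i"
    by (metis nth_equalityI)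
  then obtain i where i: "i < length w" "w ! i \<noteq> w' ! i" "\<forall>p<i. w ! p = w' ! p"
    using exists_least_iff[of "\<lambda>i. i < length w \<and> w ! i \<noteq> w' ! i"] by (metis order.strict_trans)
  then consider "w ! i < w' ! i" | "w' ! i < w ! i"
    by linarith
  then show False
  proof cases
    case 1
    then show False
      using hard_strings_distinct_leaves_aux[OF T b, of w w' i] w n i leaf by simp
  next
    case 2
    then show False
      using hard_strings_distinct_leaves_aux[OF T b, of w' w i] w n i leaf by simp
  qed
qed

section \<open>Counting the leaves reached\<close>

instance edge :: finite
proof
  have "UNIV = {LT, EQ, GT}"
    using edge.exhaust by auto
  then show "finite (UNIV :: edge set)"
    by (metis finite.emptyI finite.insertI)
qed

text \<open>Base 4 absorbs the sum of the powers of 3, as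
  \<open>4 ^ h + 3 * 4 ^ h = 4 ^ Suc h\<close>, and has an integral binary logarithm.\<close>

lemma card_edge_paths_le: "card {xs :: edge list. length xs \<le> h} \<le> 4 ^ h"
proof -
  have UNIV: "UNIV = {LT, EQ, GT}"
    using edge.exhaust by auto
  have "card {xs :: edge list. length xs \<le> h} = (\<Sum>i\<le>h. 3 ^ i)"
    using card_lists_length_le[of "UNIV :: edge set" h] by (simp flip: UNIV) (simp add: UNIV numeral_3_eq_3)
  also have "\<dots> \<le> 4 ^ h"
  proof (induction h)
    case (Suc h)
    have "(3::nat) ^ Suc h \<le> 3 * 4 ^ h"
      by (simp add: power_mono)
    then show ?case
      using Suc by simp
  qed simp
  finally show ?thesis .
qed

text \<open>The \<open>k ^ m\<close> words give distinct edge paths, none longer than the worst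
  case.\<close>

lemma power_le_worst_case:
  fixes b :: "nat \<Rightarrow> 'a::linorder"
  assumes T: "processes_length n T" "finds_lz A n T"
    and b: "strict_mono_on {..<2 * k} b" "b ` {..<2 * k} \<subseteq> A"
    and n: "2 * (k + m) \<le> n" and k: "0 < k" "2 * k \<le> \<sigma>"
  shows "k ^ m \<le> 4 ^ worst_case_comparisons A n \<sigma> T"
proof -
  let ?W = "{w. set w \<subseteq> {..<k} \<and> length w = m}"
  let ?f = "\<lambda>w. leaf_reached T (hard_string b n k w)"
  have "length (?f w) \<le> worst_case_comparisons A n \<sigma> T" if "w \<in> ?W" for w
  proof (rule length_leaf_reached_le_worst_case)
    have sub: "set (hard_string b n k w) \<subseteq> b ` {..<2 * k}"
      using hard_string_letters[of w k b n] that k by fastforce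
    then show "hard_string b n k w \<in> strings A n"
      using b(2) by (auto simp: strings_def)
    have "card (set (hard_string b n k w)) \<le> card (b ` {..<2 * k})"
      using sub by (intro card_mono) auto
    also have "\<dots> \<le> 2 * k"
      using card_image_le[of "{..<2 * k}" b] by simp
    finally show "card (set (hard_string b n k w)) \<le> \<sigma>"
      using k by simp
  qed
  moreover have "finite {xs :: edge list. length xs \<le> worst_case_comparisons A n \<sigma> T}"
    using finite_lists_length_le[of "UNIV :: edge set"] by simp
  ultimately have "card (?f ` ?W) \<le> card {xs :: edge list. length xs \<le> worst_case_comparisons A n \<sigma> T}"
    by (intro card_mono) auto
  moreover have "card (?f ` ?W) = k ^ m"
    using card_image[OF hard_strings_distinct_leaves[OF T b n]] card_lists_length_eq[of "{..<k}" m]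
    by simp
  ultimately show ?thesis
    using card_edge_paths_le le_trans by metis
qed

section \<open>Choice of letters and numerical estimates\<close>

lemma ex_strict_mono_enumeration:
  fixes A :: "'a::linorder set"
  assumes "infinite A \<or> l \<le> card A"
  shows "\<exists>b. strict_mono_on {..<l} b \<and> b ` {..<l} \<subseteq> A"
proof -
  obtain B where B: "B \<subseteq> A" "finite B" "card B = l"
    using assms by (meson infinite_arbitrarily_large obtain_subset_with_card_n)
  show ?thesis
  proof (intro exI conjI)
    show "strict_mono_on {..<l} (\<lambda>i. sorted_list_of_set B ! i)"
      using B strict_sorted_list_of_set[of B]
      by (auto intro!: strict_mono_onI simp: sorted_wrt_iff_nth_less)
    show "(\<lambda>i. sorted_list_of_set B ! i) ` {..<l} \<subseteq> A"
    proof clarify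
      fix i assume "i < l"
      then have "sorted_list_of_set B ! i \<in> set (sorted_list_of_set B)"
        using B by (intro nth_mem) simp
      then show "sorted_list_of_set B ! i \<in> A"
        using B by auto
    qed
  qed
qed

lemma lower_bound_large_alphabet:
  fixes A :: "'a::linorder set"
  assumes T: "processes_length n T" "finds_lz A n T"
    and n: "8 \<le> n" and \<sigma>: "8 \<le> \<sigma>" "\<sigma> \<le> n" and A: "infinite A \<or> \<sigma> \<le> card A"
  shows "1 / 64 * (real n * log 2 (real \<sigma>)) \<le> real (worst_case_comparisons A n \<sigma> T)"
proof -
  \<comment> \<open>Since \<open>4 * k \<le> \<sigma> \<le> n\<close>, the initial block of length
    \<open>2 * k\<close> fills at most half of the string, leaving \<open>m\<close> linear in
    \<open>n\<close>; and \<open>8 \<le> \<sigma>\<close> makes \<open>k\<close> at least 2.\<close>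
  define k where "k = \<sigma> div 4"
  define m where "m = n div 2 - k"
  define h where "h = worst_case_comparisons A n \<sigma> T"
  have k4: "4 * k \<le> \<sigma>" "\<sigma> \<le> 4 * k + 3"
    unfolding k_def by simp_all
  obtain d where d: "n div 2 = d" "2 * d \<le> n" "n \<le> 2 * d + 1"
    by simp
  then have "d = k + m"
    unfolding m_def d(1) using \<sigma> k4 by linarith
  then have d2: "2 * (k + m) \<le> n" "n \<le> 2 * (k + m) + 1"
    using d(2,3) by simp_all
  have k: "2 \<le> k" "2 * k \<le> \<sigma>" "\<sigma> \<le> 8 * k"
    using \<sigma> k4 by linarith+
  have m: "n \<le> 8 * m"
    using k4(1) d2 \<sigma>(2) n by simp
  obtain b where "strict_mono_on {..<2 * k} b" "b ` {..<2 * k} \<subseteq> A"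
    using ex_strict_mono_enumeration[of A "2 * k"] A k(2) by (meson le_trans)
  then have "k ^ m \<le> 4 ^ h"
    unfolding h_def using k d2 by (intro power_le_worst_case[OF T]) auto
  then have "real (k ^ m) \<le> real (4 ^ h)"
    by (rule of_nat_mono)
  then have "real k ^ m \<le> 2 ^ (2 * h)"
    by (simp add: power_mult)
  then have "log 2 (real k ^ m) \<le> log 2 (2 ^ (2 * h))"
    using k by (intro log_mono) auto
  then have km: "real m * log 2 (real k) \<le> 2 * real h"
    using k by (simp add: log_nat_power)
  \<comment> \<open>With \<open>\<sigma> \<le> 8 * k\<close>, this makes the logarithms of
    \<open>k\<close> and \<open>\<sigma>\<close> comparable up to the factor 4.\<close>
  have "8 * k \<le> k ^ 4"
  proof -
    have "2 ^ 3 \<le> k ^ 3"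
      using k by (intro power_mono) auto
    then show ?thesis
      by (simp add: power_numeral_reduce)
  qed
  then have "real \<sigma> \<le> real k ^ 4"
    using k(3) by (metis le_trans of_nat_le_iff of_nat_power)
  then have "log 2 (real \<sigma>) \<le> log 2 (real k ^ 4)"
    using \<sigma> k by (intro log_mono) auto
  then have k\<sigma>: "log 2 (real \<sigma>) \<le> 4 * log 2 (real k)"
    using k by (simp add: log_nat_power)
  \<comment> \<open>The constant 64 is 8 from \<open>n \<le> 8 * m\<close>, times 4 from the
    logarithms, times 2 from the base 4.\<close>
  have "real n * log 2 (real \<sigma>) \<le> (8 * real m) * (4 * log 2 (real k))"
    using k k\<sigma> \<sigma> m by (intro mult_mono) auto
  also have "\<dots> \<le> 64 * real h"
    using km by simp
  finally show ?thesis
    by (simp add: h_def)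
qed

text \<open>The constants are uniform in the alphabet. The range \<open>\<sigma> \<le> n\<close> is
  natural: a string of length \<open>n\<close> has at most \<open>n\<close> distinct letters, so
  \<open>H\<close> is constant in \<open>\<sigma>\<close> from \<open>n\<close> on while the
  logarithm grows.\<close>

theorem theorem1:
  "\<exists>c>0. \<exists>N. \<forall>(A :: 'a::linorder set) n \<sigma>.
     N \<le> n \<longrightarrow> 1 \<le> \<sigma> \<longrightarrow> \<sigma> \<le> n \<longrightarrow> (infinite A \<or> \<sigma> \<le> card A) \<longrightarrow>
     c * (real n * log 2 (real \<sigma>)) \<le> real (H A n \<sigma>)"
proof (rule exI[of _ "1 / 64"], rule conjI, simp, rule exI[of _ 8], intro allI impI)
  fix A :: "'a set" and n \<sigma> :: nat
  assume n: "8 \<le> n" and \<sigma>: "1 \<le> \<sigma>" "\<sigma> \<le> n" and A: "infinite A \<or> \<sigma> \<le> card A"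
  obtain T where T: "processes_length n T" "finds_lz A n T"
    and H: "H A n \<sigma> = worst_case_comparisons A n \<sigma> T"
    using H_attained by blast
  \<comment> \<open>The logarithm vanishes in the first case and is at most 3 in the second, where
    the linear bound suffices; only the third needs the counting.\<close>
  consider "\<sigma> = 1" | "2 \<le> \<sigma>" "\<sigma> < 8" | "8 \<le> \<sigma>"
    using \<sigma> by linarith
  then show "1 / 64 * (real n * log 2 (real \<sigma>)) \<le> real (H A n \<sigma>)"
  proof cases
    case 1
    then show ?thesis
      by simp
  next
    case 2
    obtain b :: "nat \<Rightarrow> 'a" where b: "strict_mono_on {..<2} b" "b ` {..<2} \<subseteq> A"
      using ex_strict_mono_enumeration[of A 2] A 2 by (meson le_trans)
    then have "b 0 < b 1"
      by (auto intro: strict_mono_onD)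
    then have "n \<le> 2 * H A n \<sigma> + 2"
      unfolding H using b(2) \<sigma> by (intro linear_lower_bound[OF T, of "b 0" "b 1"]) auto
    \<comment> \<open>From \<open>8 \<le> n\<close> the value of \<open>H\<close> is at least 3, so
      the summand 2 is absorbed.\<close>
    then have "real n \<le> 4 * real (H A n \<sigma>)"
      using n by linarith
    moreover have "log 2 (real \<sigma>) \<le> 3"
      using 2 by (simp add: log_le_iff)
    then have "real n * log 2 (real \<sigma>) \<le> real n * 3"
      by (intro mult_left_mono) auto
    ultimately show ?thesis
      by simp
  next
    case 3
    then show ?thesis
      unfolding H using lower_bound_large_alphabet[OF T n _ \<sigma>(2) A] by simp
  qed
qed

end
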